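(* Let $\Bbbk$ be a field of characteristic zero, let $A$ be a Frobenius algebra over $\Bbbk$ with respect to a bilinear form $\langle-,-\rangle$, and let $\sigma:A\to A$ be the corresponding Nakayama automorphism. If $\delta:A\to A$ is a nilpotent derivation, then $$\frac{\mathrm d}{\mathrm dt}\Big|_{t=0}\mathrm{jac}_\sigma(\exp(t\delta))=\sigma^{-1}(\mathrm{div}_\sigma(\delta)).$$
   Context: Algebras are associative and unital over $\Bbbk$, and derivations are $\Bbbk$-linear. A Frobenius algebra is a finite-dimensional algebra $A$ endowed with a non-degenerate bilinear form $\langle-,-\rangle:A\times A\to\Bbbk$ that is associative: $\langle ab,c\rangle=\langle a,bc\rangle$ for all $a,b,c\in A$. Its Nakayama automorphism is the unique algebra automorphism $\sigma:A\to A$ such that $\langle a,b\rangle=\langle b,\sigma(a)\rangle$ for all $a,b\in A$. For an algebra endomorphism $u$ of $A$, the Nakayama Jacobian $\mathrm{jac}_\sigma(u)$ is the unique element of $A$ with $\langle u(a),u(b)\rangle=\langle\mathrm{jac}_\sigma(u)\cdot a,b\rangle$ for all $a,b\in A$. For a derivation $\delta$ of $A$, the Nakayama divergence $\mathrm{div}_\sigma(\delta)$ is the unique element of $A$ with $\langle\delta(a),b\rangle+\langle a,\delta(b)\rangle=\langle a,b\cdot\mathrm{div}_\sigma(\delta)\rangle$ for all $a,b\in A$. For a nilpotent derivation $\delta$ and $t\in\Bbbk$, $\exp(t\delta)=\sum_{k\ge0}\frac{t^k}{k!}\delta^k$, a finite sum, which is an algebra automorphism of $A$. The function $t\in\Bbbk\mapsto\mathrm{jac}_\sigma(\exp(t\delta))\in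 A$ is given by a polynomial in $t$ with coefficients in $A$, and its derivative at $t=0$ means the coefficient of $t$ in that polynomial. *)

theory Defs
  imports "HOL-Computational_Algebra.Polynomial" "HOL-Library.Groups_Big_Fun"
begin

text \<open>The sort \<open>{ring, monoid_mult}\<close> is that of unital associative rings; unlike \<open>ring_1\<close>
  it does not exclude the zero ring.\<close>

locale unital_algebra = vector_space scale
  for scale :: "'k::field \<Rightarrow> 'a::{ring,monoid_mult} \<Rightarrow> 'a" +
  assumes scale_mult_left: "scale c a * b = scale c (a * b)"
    and scale_mult_right: "a * scale c b = scale c (a * b)"

locale frobenius_algebra = unital_algebra scale
  for scale :: "'k::field \<Rightarrow> 'a::{ring,monoid_mult} \<Rightarrow> 'a" +
  fixes form :: "'a \<Rightarrow> 'a \<Rightarrow> 'k"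
  assumes finite_dimensional: "\<exists>B. finite B \<and> span B = UNIV"
    and form_linear_left: "Vector_Spaces.linear scale (*) (\<lambda>a. form a b)"
    and form_linear_right: "Vector_Spaces.linear scale (*) (\<lambda>b. form a b)"
    and form_nondegenerate_left: "(\<And>b. form a b = 0) \<Longrightarrow> a = 0"
    and form_nondegenerate_right: "(\<And>a. form a b = 0) \<Longrightarrow> b = 0"
    and form_assoc: "form (a * b) c = form a (b * c)"

definition algebra_endomorphism ::
  "('k::field \<Rightarrow> 'a::{ring,monoid_mult} \<Rightarrow> 'a) \<Rightarrow> ('a \<Rightarrow> 'a) \<Rightarrow> bool" where
  "algebra_endomorphism scale u \<longleftrightarrow>
     Vector_Spaces.linear scale scale u \<and> u 1 = 1 \<and> (\<forall>a b. u (a * b) = u a * u b)"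

definition algebra_automorphism ::
  "('k::field \<Rightarrow> 'a::{ring,monoid_mult} \<Rightarrow> 'a) \<Rightarrow> ('a \<Rightarrow> 'a) \<Rightarrow> bool" where
  "algebra_automorphism scale u \<longleftrightarrow> algebra_endomorphism scale u \<and> bij u"

definition derivation ::
  "('k::field \<Rightarrow> 'a::{ring,monoid_mult} \<Rightarrow> 'a) \<Rightarrow> ('a \<Rightarrow> 'a) \<Rightarrow> bool" where
  "derivation scale \<delta> \<longleftrightarrow>
     Vector_Spaces.linear scale scale \<delta> \<and> (\<forall>a b. \<delta> (a * b) = \<delta> a * b + a * \<delta> b)"

definition nilpotent_map :: "('a::zero \<Rightarrow> 'a) \<Rightarrow> bool" where
  "nilpotent_map \<delta> \<longleftrightarrow> (\<exists>n. \<forall>a. (\<delta> ^^ n) a = 0)"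

definition nakayama_automorphism ::
  "('k::field \<Rightarrow> 'a::{ring,monoid_mult} \<Rightarrow> 'a) \<Rightarrow> ('a \<Rightarrow> 'a \<Rightarrow> 'k) \<Rightarrow> 'a \<Rightarrow> 'a" where
  "nakayama_automorphism scale form =
     (THE \<sigma>. algebra_automorphism scale \<sigma> \<and> (\<forall>a b. form a b = form b (\<sigma> a)))"

definition nakayama_jacobian ::
  "('a::times \<Rightarrow> 'a \<Rightarrow> 'k) \<Rightarrow> ('a \<Rightarrow> 'a) \<Rightarrow> 'a" where
  "nakayama_jacobian form u = (THE j. \<forall>a b. form (u a) (u b) = form (j * a) b)"

definition nakayama_divergence ::
  "('a::times \<Rightarrow> 'a \<Rightarrow> 'k::plus) \<Rightarrow> ('a \<Rightarrow> 'a) \<Rightarrow> 'a" where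
  "nakayama_divergence form \<delta> =
     (THE d. \<forall>a b. form (\<delta> a) b + form a (\<delta> b) = form a (b * d))"

text \<open>\<open>Sum_any\<close> sums over the (finite, for nilpotent \<open>\<delta>\<close>) set of \<open>k\<close> with nonzero summand.\<close>

definition exp_derivation ::
  "('k::field_char_0 \<Rightarrow> 'a::ring \<Rightarrow> 'a) \<Rightarrow> ('a \<Rightarrow> 'a) \<Rightarrow> 'k \<Rightarrow> 'a \<Rightarrow> 'a" where
  "exp_derivation scale \<delta> t a = Sum_any (\<lambda>k. scale (t ^ k / fact k) ((\<delta> ^^ k) a))"

text \<open>Coefficients of the polynomial lie in \<open>'a\<close> while the argument is a scalar, so the
  library's \<open>poly\<close> does not apply.\<close>

definition poly_at_scalar ::
  "('k::field \<Rightarrow> 'a::ring \<Rightarrow> 'a) \<Rightarrow> 'a poly \<Rightarrow> 'k \<Rightarrow> 'a" where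
  "poly_at_scalar scale p t = (\<Sum>i\<le>degree p. scale (t ^ i) (coeff p i))"

definition has_polynomial_derivative_at_0 ::
  "('k::field \<Rightarrow> 'a::ring \<Rightarrow> 'a) \<Rightarrow> ('k \<Rightarrow> 'a) \<Rightarrow> 'a \<Rightarrow> bool" where
  "has_polynomial_derivative_at_0 scale F D \<longleftrightarrow>
     (\<exists>p. (\<forall>t. F t = poly_at_scalar scale p t) \<and> coeff p 1 = D)"


context frobenius_algebra
begin

lemma form_simps:
  "form (a + a') b = form a b + form a' b"
  "form a (b + b') = form a b + form a b'"
  "form (scale c a) b = c * form a b"
  "form a (scale c b) = c * form a b"
  using form_linear_left[of b] form_linear_right[of a]
  by (auto simp: Vector_Spaces.linear_iff)

lemma form_diff:
  "form (a - a') b = form a b - form a' b"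
  "form a (b - b') = form a b - form a b'"
proof -
  show "form (a - a') b = form a b - form a' b"
    using form_simps(1)[of "a - a'" a' b] by simp
  show "form a (b - b') = form a b - form a b'"
    using form_simps(2)[of a "b - b'" b'] by simp
qed

lemma form_eq_left: "(\<And>b. form a b = form a' b) \<Longrightarrow> a = a'"
  using form_nondegenerate_left[of "a - a'"] by (simp add: form_diff)

lemma form_eq_right: "(\<And>a. form a b = form a b') \<Longrightarrow> b = b'"
  using form_nondegenerate_right[of "b - b'"] by (simp add: form_diff)

lemma functional_representation:
  assumes lin: "\<And>b. Vector_Spaces.linear scale (*) (\<lambda>a. g a b)"
    "\<And>a. Vector_Spaces.linear scale (*) (\<lambda>b. g a b)"
    and nd: "\<And>a. (\<And>b. g a b = 0) \<Longrightarrow> a = 0"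
    and f: "Vector_Spaces.linear scale (*) f"
  shows "\<exists>a. \<forall>b. g a b = f b"
proof -
  obtain C where C: "finite C" "span C = UNIV" using finite_dimensional by blast
  obtain B where B: "B \<subseteq> C" "independent B" "C \<subseteq> span B"
    using maximal_independent_subset[of C] by blast
  have finB: "finite B" using B C finite_subset by blast
  have spB: "span B = UNIV" using span_minimal[OF B(3) subspace_span] C(2) by auto
  interpret fd: finite_dimensional_vector_space scale B
    by unfold_locales (use finB spB B in auto)
  have agree: "h b = h' b" if "Vector_Spaces.linear scale (*) h"
    "Vector_Spaces.linear scale (*) h'" "\<And>b. b \<in> B \<Longrightarrow> h b = h' b" for h h' b
  proof -
    interpret vector_space_pair scale "(*) :: 'k \<Rightarrow> 'k \<Rightarrow> 'k"
      by (rule vector_space_pair.intro)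
        (use that(1) in \<open>auto simp: Vector_Spaces.linear_iff\<close>)
    show ?thesis using linear_eq_on[OF that(1,2), of b B] that(3) spB by auto
  qed
  define T where "T a = (\<Sum>b\<in>B. scale (g a b) b)" for a
  have gadd: "g (a + a') b = g a b + g a' b" "g (scale c a) b = c * g a b" for a a' b c
    using lin(1)[of b] by (auto simp: Vector_Spaces.linear_iff)
  have gdiff: "g (a - a') b = g a b - g a' b" for a a' b
    using gadd(1)[of "a - a'" a' b] by simp
  have uniq: "h b = h' b" if "(\<Sum>b\<in>B. scale (h b) b) = (\<Sum>b\<in>B. scale (h' b) b)" "b \<in> B" for h h' b
  proof -
    have "(\<Sum>b\<in>B. scale (h b - h' b) b) = 0"
      using that by (simp add: scale_left_diff_distrib sum_subtractf)
    from independentD[OF B(2) finB _ this \<open>b \<in> B\<close>] show ?thesis by simp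
  qed
  have Tlin: "Vector_Spaces.linear scale scale T"
    unfolding Vector_Spaces.linear_iff T_def
    by (auto simp: gadd scale_left_distrib sum.distrib scale_sum_right vector_space_axioms)
  have "inj T"
  proof (rule injI)
    fix x y assume "T x = T y"
    then have "g x b = g y b" if "b \<in> B" for b using uniq that unfolding T_def by blast
    then have "g x b = g y b" for b using agree[OF lin(2) lin(2)] by blast
    then show "x = y" using nd[of "x - y"] by (simp add: gdiff)
  qed
  then have "surj T" using fd.linear_inj_imp_surj[OF Tlin] by blast
  then obtain a where "T a = (\<Sum>b\<in>B. scale (f b) b)" by (metis surjD)
  then have "g a b = f b" if "b \<in> B" for b using uniq that unfolding T_def by blast
  then show ?thesis using agree[OF lin(2) f] by blast
qed

lemma representation_left:
  "Vector_Spaces.linear scale (*) f \<Longrightarrow> \<exists>a. \<forall>b. form a b = f b"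
  by (rule functional_representation[of form])
    (auto intro: form_linear_left form_linear_right form_nondegenerate_left)

lemma representation_right:
  "Vector_Spaces.linear scale (*) f \<Longrightarrow> \<exists>b. \<forall>a. form a b = f a"
  by (rule functional_representation[of "\<lambda>x y. form y x"])
    (auto intro: form_linear_left form_linear_right form_nondegenerate_right)

lemma form_one: "form a b = form (a * b) 1" "form a b = form 1 (a * b)"
proof -
  show "form a b = form (a * b) 1" by (simp only: form_assoc mult_1_right)
  show "form a b = form 1 (a * b)" by (simp only: form_assoc[symmetric] mult_1)
qed

theorem nakayama_automorphism_ex1:
  "\<exists>!\<sigma>. algebra_automorphism scale \<sigma> \<and> (\<forall>a b. form a b = form b (\<sigma> a))"
proof (rule ex_ex1I)
  have "\<forall>a. \<exists>s. \<forall>b. form b s = form a b"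
    using representation_right form_linear_right by blast
  then obtain \<sigma> where s: "\<And>a b. form b (\<sigma> a) = form a b" by metis
  have "\<sigma> (x * y) = \<sigma> x * \<sigma> y" for x y
  proof (rule form_eq_right)
    fix b
    have "form b (\<sigma> (x * y)) = form (y * b) (\<sigma> x)" by (simp only: s form_assoc)
    also have "\<dots> = form y (b * \<sigma> x)" by (rule form_assoc)
    also have "\<dots> = form (b * \<sigma> x) (\<sigma> y)" by (simp only: s)
    also have "\<dots> = form b (\<sigma> x * \<sigma> y)" by (rule form_assoc)
    finally show "form b (\<sigma> (x * y)) = form b (\<sigma> x * \<sigma> y)" .
  qed
  moreover have "\<sigma> 1 = 1"
  proof (rule form_eq_right)
    show "form b (\<sigma> 1) = form b 1" for b
      using form_one(1)[of 1 b] by (simp only: s mult_1)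
  qed
  moreover have "Vector_Spaces.linear scale scale \<sigma>"
    unfolding Vector_Spaces.linear_iff
    by (auto intro!: form_eq_right simp: s form_simps vector_space_axioms)
  moreover have "inj \<sigma>"
    by (rule injI, rule form_eq_left) (metis s)
  moreover have "surj \<sigma>"
    unfolding surj_def
  proof
    fix y
    obtain a where "\<forall>b. form a b = form b y"
      using representation_left form_linear_left by blast
    then show "\<exists>x. y = \<sigma> x" by (intro exI[of _ a] form_eq_right) (simp add: s)
  qed
  ultimately show "\<exists>\<sigma>. algebra_automorphism scale \<sigma> \<and> (\<forall>a b. form a b = form b (\<sigma> a))"
    by (intro exI[of _ \<sigma>]) (simp add: algebra_automorphism_def algebra_endomorphism_def bij_def s)
next
  fix \<sigma> \<tau>
  assume "algebra_automorphism scale \<sigma> \<and> (\<forall>a b. form a b = form b (\<sigma> a))"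
    and "algebra_automorphism scale \<tau> \<and> (\<forall>a b. form a b = form b (\<tau> a))"
  then show "\<sigma> = \<tau>" by (intro ext form_eq_right) metis
qed

theorem nakayama_jacobian_ex1:
  assumes "algebra_endomorphism scale u"
  shows "\<exists>!j. \<forall>a b. form (u a) (u b) = form (j * a) b"
proof (rule ex_ex1I)
  have u: "u (a + b) = u a + u b" "u (scale c a) = scale c (u a)" "u (a * b) = u a * u b" for a b c
    using assms by (auto simp: algebra_endomorphism_def Vector_Spaces.linear_iff)
  have "Vector_Spaces.linear scale (*) (\<lambda>a. form 1 (u a))"
    using form_linear_left[of 1] by (auto simp: Vector_Spaces.linear_iff u form_simps)
  then obtain j where "\<forall>b. form j b = form 1 (u b)" using representation_left by blast
  then show "\<exists>j. \<forall>a b. form (u a) (u b) = form (j * a) b"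
    by (intro exI[of _ j]) (simp add: form_assoc form_one(2)[of "u _"] u(3))
next
  fix j j'
  assume "\<forall>a b. form (u a) (u b) = form (j * a) b" "\<forall>a b. form (u a) (u b) = form (j' * a) b"
  then show "j = j'" by (intro form_eq_left) (metis mult_1_right)
qed

theorem nakayama_divergence_ex1:
  assumes "derivation scale \<delta>"
  shows "\<exists>!d. \<forall>a b. form (\<delta> a) b + form a (\<delta> b) = form a (b * d)"
proof (rule ex_ex1I)
  have d: "\<delta> (a + b) = \<delta> a + \<delta> b" "\<delta> (scale c a) = scale c (\<delta> a)"
    "\<delta> (a * b) = \<delta> a * b + a * \<delta> b" for a b c
    using assms by (auto simp: derivation_def Vector_Spaces.linear_iff)
  have "Vector_Spaces.linear scale (*) (\<lambda>a. form (\<delta> a) 1)"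
    using form_linear_left[of 1] by (auto simp: Vector_Spaces.linear_iff d form_simps)
  then obtain e where e: "\<And>a. form a e = form (\<delta> a) 1" using representation_right by blast
  have "form (\<delta> a) b + form a (\<delta> b) = form a (b * e)" for a b
  proof -
    have "form (\<delta> a) b + form a (\<delta> b) = form (\<delta> (a * b)) 1"
      by (simp only: d form_simps form_assoc mult_1_right)
    also have "\<dots> = form a (b * e)" by (simp only: e[symmetric] form_assoc)
    finally show ?thesis .
  qed
  then show "\<exists>d. \<forall>a b. form (\<delta> a) b + form a (\<delta> b) = form a (b * d)" by blast
next
  fix d d'
  assume "\<forall>a b. form (\<delta> a) b + form a (\<delta> b) = form a (b * d)"
    "\<forall>a b. form (\<delta> a) b + form a (\<delta> b) = form a (b * d')"
  then show "d = d'" by (intro form_eq_right) (metis mult_1)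
qed

end

lemma has_polynomial_derivative_at_0_unique:
  fixes scale :: "'k::field_char_0 \<Rightarrow> 'a::{ring,monoid_mult} \<Rightarrow> 'a"
  assumes "frobenius_algebra scale form"
    and "has_polynomial_derivative_at_0 scale F D" "has_polynomial_derivative_at_0 scale F D'"
  shows "D = D'"
proof -
  interpret frobenius_algebra scale form by fact
  obtain p q where p: "\<And>t. F t = poly_at_scalar scale p t" "coeff p 1 = D"
    and q: "\<And>t. F t = poly_at_scalar scale q t" "coeff q 1 = D'"
    using assms(2,3) unfolding has_polynomial_derivative_at_0_def by blast
  have form0: "form 0 b = 0" for b using form_diff(1)[of 0 0 b] by simp
  have ev: "form (poly_at_scalar scale r t) b = poly (map_poly (\<lambda>a. form a b) r) t" for r t b
  proof -
    have "form (\<Sum>i\<in>I. h i) b = (\<Sum>i\<in>I. form (h i) b)" if "finite I" for I and h :: "nat \<Rightarrow> 'a"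
      using that by induction (auto simp: form0 form_simps)
    then have "form (poly_at_scalar scale r t) b = (\<Sum>i\<le>degree r. form (coeff r i) b * t ^ i)"
      by (simp add: poly_at_scalar_def form_simps mult.commute)
    also have "\<dots> = (\<Sum>i\<le>degree r. coeff (map_poly (\<lambda>a. form a b) r) i * t ^ i)"
      by (simp add: coeff_map_poly form0)
    also have "\<dots> = poly (map_poly (\<lambda>a. form a b) r) t"
      unfolding poly_altdef
      by (rule sum.mono_neutral_right)
        (auto simp: coeff_eq_0 intro: order_trans[OF _ map_poly_degree_leq])
    finally show ?thesis .
  qed
  have "form D b = form D' b" for b
  proof -
    have "poly (map_poly (\<lambda>a. form a b) p) = poly (map_poly (\<lambda>a. form a b) q)"
      using ev[of p] ev[of q] p(1) q(1) by (intro ext) simp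
    then have "map_poly (\<lambda>a. form a b) p = map_poly (\<lambda>a. form a b) q"
      by (simp add: poly_eq_poly_eq_iff)
    then have "coeff (map_poly (\<lambda>a. form a b) p) 1 = coeff (map_poly (\<lambda>a. form a b) q) 1" by simp
    then show ?thesis using p(2) q(2) by (simp add: coeff_map_poly form0)
  qed
  then show ?thesis by (rule form_eq_left)
qed

end

theory Submission
  imports Defs
begin

text \<open>Let \<open>u\<^sup>*\<close> denote the left adjoint of a linear map \<open>u\<close>, so that \<open>\<langle>u\<^sup>* a, b\<rangle> = \<langle>a, u b\<rangle>\<close>. For an
  algebra endomorphism \<open>u\<close> associativity gives \<open>\<langle>u a, u b\<rangle> = \<langle>1, u (a b)\<rangle> = \<langle>u\<^sup>* 1 \<cdot> a, b\<rangle>\<close>, so the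
  Jacobian of \<open>u\<close> is \<open>u\<^sup>* 1\<close>. The adjoint of \<open>exp (t \<delta>)\<close> is \<open>exp (t \<delta>\<^sup>*)\<close>, hence the Jacobian of
  \<open>exp (t \<delta>)\<close> is \<open>exp (t \<delta>\<^sup>*) 1\<close>, a polynomial in \<open>t\<close> with linear coefficient \<open>\<delta>\<^sup>* 1\<close>. Finally
  \<open>\<langle>\<delta>\<^sup>* 1, b\<rangle> = \<langle>1, \<delta> b\<rangle> = \<langle>b, div \<delta>\<rangle>\<close>, because \<open>\<delta> 1 = 0\<close>, and so \<open>\<sigma> (\<delta>\<^sup>* 1) = div \<delta>\<close>.\<close>

lemma nilpotent_mapE:
  assumes "nilpotent_map f"
  obtains m where "\<And>k a. m \<le> k \<Longrightarrow> (f ^^ k) a = 0"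
proof -
  obtain m where m: "\<And>a. (f ^^ m) a = 0"
    using assms unfolding nilpotent_map_def by blast
  have "(f ^^ k) a = 0" if "m \<le> k" for k a
  proof -
    have "(f ^^ k) a = (f ^^ m) ((f ^^ (k - m)) a)"
      using that by (metis funpow_add comp_apply le_add_diff_inverse)
    then show ?thesis by (simp add: m)
  qed
  then show thesis by (rule that)
qed

lemma (in vector_space) linear_funpow:
  assumes "Vector_Spaces.linear scale scale f"
  shows "Vector_Spaces.linear scale scale (f ^^ k)"
proof (induction k)
  case 0
  show ?case using linear_id by (simp add: id_def)
next
  case (Suc k)
  then show ?case
    using Vector_Spaces.linear_compose[OF _ assms] by (simp add: comp_def)
qed

lemma sum_product_lessThan_antidiagonal:
  fixes f g :: "nat \<Rightarrow> 'a::semiring_0"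
  assumes "\<And>i. m \<le> i \<Longrightarrow> f i = 0" and "\<And>j. n \<le> j \<Longrightarrow> g j = 0"
  shows "(\<Sum>i<m. f i) * (\<Sum>j<n. g j) = (\<Sum>k<m + n. \<Sum>i\<le>k. f i * g (k - i))"
proof -
  have "(\<Sum>i<m. f i) * (\<Sum>j<n. g j) = (\<Sum>(i, j)\<in>{..<m} \<times> {..<n}. f i * g j)"
    by (simp add: sum_product sum.cartesian_product)
  also have "\<dots> = (\<Sum>(i, j)\<in>{(i, j). i + j < m + n}. f i * g j)"
  proof (rule sum.mono_neutral_left)
    show "finite {(i, j). i + j < m + n}"
      by (rule finite_subset[of _ "{..<m + n} \<times> {..<m + n}"]) auto
    have "f i * g j = 0" if "\<not> (i < m \<and> j < n)" for i j
      using that by (cases "i < m") (auto simp: assms)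
    then show "\<forall>x\<in>{(i, j). i + j < m + n} - {..<m} \<times> {..<n}. (case x of (i, j) \<Rightarrow> f i * g j) = 0"
      by auto
  qed auto
  also have "\<dots> = (\<Sum>k<m + n. \<Sum>i\<le>k. f i * g (k - i))"
    by (rule sum.triangle_reindex)
  finally show ?thesis .
qed

lemma has_polynomial_derivative_at_0_sum:
  assumes "vector_space scale" and "\<And>t. F t = (\<Sum>i\<le>n. scale (t ^ i) (c i))" and "1 \<le> n"
  shows "has_polynomial_derivative_at_0 scale F (c 1)"
proof -
  interpret vector_space scale by fact
  define p where "p = (\<Sum>i\<le>n. monom (c i) i)"
  have coeff_p: "coeff p i = c i" if "i \<le> n" for i
    unfolding p_def using that by (rule coeff_sum_monom)
  have "degree p \<le> n"
    unfolding p_def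
    by (rule degree_sum_le) (auto intro: order_trans[OF degree_monom_le])
  then have "poly_at_scalar scale p t = (\<Sum>i\<le>n. scale (t ^ i) (coeff p i))" for t
    unfolding poly_at_scalar_def by (intro sum.mono_neutral_left) (auto simp: coeff_eq_0)
  then have "F t = poly_at_scalar scale p t" for t
    by (simp add: assms(2) coeff_p)
  then show ?thesis
    unfolding has_polynomial_derivative_at_0_def using coeff_p[OF assms(3)] by blast
qed

lemma exp_derivation_eq_sum:
  fixes scale :: "'k::field_char_0 \<Rightarrow> 'a::ring \<Rightarrow> 'a"
  assumes "vector_space scale" and "\<And>k. n \<le> k \<Longrightarrow> (\<delta> ^^ k) a = 0"
  shows "exp_derivation scale \<delta> t a = (\<Sum>k<n. scale (t ^ k / fact k) ((\<delta> ^^ k) a))"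
proof -
  interpret vector_space scale by fact
  have "k < n" if "scale (t ^ k / fact k) ((\<delta> ^^ k) a) \<noteq> 0" for k
    using assms(2) that by (cases "k < n") auto
  then show ?thesis
    unfolding exp_derivation_def by (intro Sum_any.expand_superset) auto
qed

lemma has_polynomial_derivative_at_0_exp_derivation:
  fixes scale :: "'k::field_char_0 \<Rightarrow> 'a::ring \<Rightarrow> 'a"
  assumes "vector_space scale" and "nilpotent_map \<delta>"
  shows "has_polynomial_derivative_at_0 scale (\<lambda>t. exp_derivation scale \<delta> t a) (\<delta> a)"
proof -
  interpret vector_space scale by fact
  obtain m where m: "\<And>k a. m \<le> k \<Longrightarrow> (\<delta> ^^ k) a = 0"
    using assms(2) by (rule nilpotent_mapE) blast
  define c where "c k = scale (1 / fact k) ((\<delta> ^^ k) a)" for k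
  have "exp_derivation scale \<delta> t a = (\<Sum>k\<le>Suc m. scale (t ^ k) (c k))" for t
    using exp_derivation_eq_sum[OF assms(1), of "Suc (Suc m)" \<delta> a t] m
    by (simp add: c_def lessThan_Suc_atMost del: sum.lessThan_Suc sum.atMost_Suc)
  then have "has_polynomial_derivative_at_0 scale (\<lambda>t. exp_derivation scale \<delta> t a) (c 1)"
    by (rule has_polynomial_derivative_at_0_sum[OF assms(1)]) simp
  then show ?thesis by (simp add: c_def)
qed

lemma linear_exp_derivation:
  fixes scale :: "'k::field_char_0 \<Rightarrow> 'a::ring \<Rightarrow> 'a"
  assumes "Vector_Spaces.linear scale scale \<delta>" and "nilpotent_map \<delta>"
  shows "Vector_Spaces.linear scale scale (exp_derivation scale \<delta> t)"
proof -
  interpret \<delta>: Vector_Spaces.linear scale scale \<delta> by fact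
  interpret vector_space_pair scale scale ..
  obtain m where m: "\<And>k a. m \<le> k \<Longrightarrow> (\<delta> ^^ k) a = 0"
    using assms(2) by (rule nilpotent_mapE) blast
  have "exp_derivation scale \<delta> t = (\<lambda>a. \<Sum>k<m. scale (t ^ k / fact k) ((\<delta> ^^ k) a))"
    by (rule ext) (rule exp_derivation_eq_sum[OF \<delta>.vs1.vector_space_axioms m])
  then show ?thesis
    by (simp add: linear_compose_sum linear_compose_scale_right \<delta>.vs1.linear_funpow assms(1))
qed

lemma derivation_one:
  assumes "derivation scale \<delta>"
  shows "\<delta> 1 = 0"
proof -
  have "\<delta> (1 * 1) = \<delta> 1 * 1 + 1 * \<delta> 1"
    using assms unfolding derivation_def by blast
  then show ?thesis by simp
qed

lemma (in unital_algebra) derivation_funpow_mult: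
  assumes "derivation scale \<delta>"
  shows "(\<delta> ^^ n) (a * b)
    = (\<Sum>i\<le>n. scale (of_nat (n choose i)) ((\<delta> ^^ i) a * (\<delta> ^^ (n - i)) b))"
proof (induction n)
  case 0
  show ?case by simp
next
  case (Suc n)
  interpret \<delta>: Vector_Spaces.linear scale scale \<delta>
    using assms by (simp add: derivation_def)
  have Leibniz: "\<delta> (x * y) = \<delta> x * y + x * \<delta> y" for x y
    using assms by (simp add: derivation_def)
  define X where "X i = (\<delta> ^^ i) a * (\<delta> ^^ (Suc n - i)) b" for i
  have "(\<delta> ^^ Suc n) (a * b)
      = (\<Sum>i\<le>n. scale (of_nat (n choose i)) (\<delta> ((\<delta> ^^ i) a * (\<delta> ^^ (n - i)) b)))"
    by (simp add: Suc \<delta>.sum \<delta>.scale)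
  also have "\<dots> = (\<Sum>i\<le>n. scale (of_nat (n choose i)) (X (Suc i)))
      + (\<Sum>i\<le>n. scale (of_nat (n choose i)) (X i))"
    by (simp add: X_def Leibniz scale_right_distrib sum.distrib Suc_diff_le)
  also have "(\<Sum>i\<le>n. scale (of_nat (n choose i)) (X i))
      = (\<Sum>i\<le>Suc n. scale (of_nat (n choose i)) (X i))"
    by (simp add: binomial_eq_0)
  also have "\<dots> = X 0 + (\<Sum>i\<le>n. scale (of_nat (n choose Suc i)) (X (Suc i)))"
    by (subst sum.atMost_Suc_shift) simp
  also have "(\<Sum>i\<le>n. scale (of_nat (n choose i)) (X (Suc i))) + \<dots>
      = X 0 + (\<Sum>i\<le>n. scale (of_nat (Suc n choose Suc i)) (X (Suc i)))"
    by (simp add: scale_left_distrib sum.distrib)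
  also have "\<dots> = (\<Sum>i\<le>Suc n. scale (of_nat (Suc n choose i)) (X i))"
    by (subst sum.atMost_Suc_shift) simp
  finally show ?case by (simp only: X_def)
qed

lemma derivation_funpow_mult_div_fact:
  fixes scale :: "'k::field_char_0 \<Rightarrow> 'a::{ring,monoid_mult} \<Rightarrow> 'a"
  assumes "unital_algebra scale" and "derivation scale \<delta>"
  shows "scale (t ^ n / fact n) ((\<delta> ^^ n) (a * b))
    = (\<Sum>i\<le>n. scale (t ^ i / fact i) ((\<delta> ^^ i) a)
        * scale (t ^ (n - i) / fact (n - i)) ((\<delta> ^^ (n - i)) b))"
proof -
  interpret unital_algebra scale by fact
  have coefficient: "t ^ n / fact n * of_nat (n choose i)
      = t ^ i / fact i * (t ^ (n - i) / fact (n - i))" if "i \<le> n" for i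
    using that by (simp add: binomial_fact flip: power_add)
  have mult_scale: "scale c x * scale d y = scale (c * d) (x * y)" for c d x y
    by (simp add: scale_mult_left scale_mult_right mult.commute)
  show ?thesis
    unfolding derivation_funpow_mult[OF assms(2)] scale_sum_right scale_scale mult_scale
    by (rule sum.cong) (simp_all only: coefficient atMost_iff)
qed

lemma exp_derivation_mult:
  fixes scale :: "'k::field_char_0 \<Rightarrow> 'a::{ring,monoid_mult} \<Rightarrow> 'a"
  assumes "unital_algebra scale" and "derivation scale \<delta>" and "nilpotent_map \<delta>"
  shows "exp_derivation scale \<delta> t (a * b)
    = exp_derivation scale \<delta> t a * exp_derivation scale \<delta> t b"
proof -
  interpret unital_algebra scale by fact
  obtain m where m: "\<And>k a. m \<le> k \<Longrightarrow> (\<delta> ^^ k) a = 0"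
    using assms(3) by (rule nilpotent_mapE) blast
  let ?S = "\<lambda>x k. scale (t ^ k / fact k) ((\<delta> ^^ k) x)"
  have exp_eq: "exp_derivation scale \<delta> t x = (\<Sum>k<n. ?S x k)" if "m \<le> n" for x n
    using exp_derivation_eq_sum[OF vector_space_axioms] m that by simp
  have "exp_derivation scale \<delta> t (a * b) = (\<Sum>k<m + m. \<Sum>i\<le>k. ?S a i * ?S b (k - i))"
    by (simp only: exp_eq[of "m + m", OF le_add1] derivation_funpow_mult_div_fact[OF assms(1,2)])
  also have "\<dots> = (\<Sum>k<m. ?S a k) * (\<Sum>k<m. ?S b k)"
    by (rule sum_product_lessThan_antidiagonal[symmetric]) (simp_all add: m)
  also have "\<dots> = exp_derivation scale \<delta> t a * exp_derivation scale \<delta> t b"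
    by (simp only: exp_eq[OF order_refl])
  finally show ?thesis .
qed

lemma exp_derivation_one:
  fixes scale :: "'k::field_char_0 \<Rightarrow> 'a::{ring,monoid_mult} \<Rightarrow> 'a"
  assumes "derivation scale \<delta>"
  shows "exp_derivation scale \<delta> t 1 = 1"
proof -
  interpret \<delta>: Vector_Spaces.linear scale scale \<delta>
    using assms by (simp add: derivation_def)
  have "(\<delta> ^^ Suc k) 1 = 0" for k
    by (induction k) (simp_all add: derivation_one[OF assms])
  then have "(\<delta> ^^ k) 1 = 0" if "1 \<le> k" for k
    using that by (cases k) auto
  from exp_derivation_eq_sum[OF \<delta>.vs1.vector_space_axioms this] show ?thesis by simp
qed

theorem algebra_endomorphism_exp_derivation:
  fixes scale :: "'k::field_char_0 \<Rightarrow> 'a::{ring,monoid_mult} \<Rightarrow> 'a"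
  assumes "unital_algebra scale" and "derivation scale \<delta>" and "nilpotent_map \<delta>"
  shows "algebra_endomorphism scale (exp_derivation scale \<delta> t)"
  unfolding algebra_endomorphism_def
proof (intro conjI allI)
  show "exp_derivation scale \<delta> t 1 = 1"
    using assms(2) by (rule exp_derivation_one)
  show "Vector_Spaces.linear scale scale (exp_derivation scale \<delta> t)"
    using assms(2,3) by (simp add: derivation_def linear_exp_derivation)
qed (rule exp_derivation_mult[OF assms])

context frobenius_algebra
begin

lemma form_zero: "form 0 b = 0" "form a 0 = 0"
  using form_diff(1)[of 0 0 b] form_diff(2)[of a 0 0] by simp_all

lemma form_sum_left: "form (sum f S) b = (\<Sum>i\<in>S. form (f i) b)"
  by (rule module_hom.sum[OF Vector_Spaces.linear.axioms(3)[OF form_linear_left]])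

lemma form_sum_right: "form a (sum f S) = (\<Sum>i\<in>S. form a (f i))"
  by (rule module_hom.sum[OF Vector_Spaces.linear.axioms(3)[OF form_linear_right]])

definition left_adjoint :: "('a \<Rightarrow> 'a) \<Rightarrow> 'a \<Rightarrow> 'a" where
  "left_adjoint u a = (THE a'. \<forall>b. form a' b = form a (u b))"

lemma left_adjoint_eqI:
  assumes "\<And>b. form a' b = form a (u b)"
  shows "left_adjoint u a = a'"
  unfolding left_adjoint_def
  by (rule the_equality) (use assms in \<open>auto intro: form_eq_left\<close>)

lemma form_left_adjoint:
  assumes "Vector_Spaces.linear scale scale u"
  shows "form (left_adjoint u a) b = form a (u b)"
proof -
  have "Vector_Spaces.linear scale (*) (\<lambda>b. form a (u b))"
    using Vector_Spaces.linear_compose[OF assms form_linear_right] by (simp add: comp_def)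
  then obtain a' where "\<And>b. form a' b = form a (u b)"
    using representation_left by blast
  then show ?thesis using left_adjoint_eqI by metis
qed

lemma form_left_adjoint_funpow:
  assumes "Vector_Spaces.linear scale scale u"
  shows "form ((left_adjoint u ^^ k) a) b = form a ((u ^^ k) b)"
proof (induction k arbitrary: b)
  case (Suc k)
  have "form ((left_adjoint u ^^ Suc k) a) b = form ((left_adjoint u ^^ k) a) (u b)"
    by (simp add: form_left_adjoint[OF assms])
  also have "\<dots> = form a ((u ^^ k) (u b))" by (rule Suc)
  also have "\<dots> = form a ((u ^^ Suc k) b)" by (simp add: funpow_swap1)
  finally show ?case .
qed simp

lemma nilpotent_map_left_adjoint:
  assumes "Vector_Spaces.linear scale scale u" and "nilpotent_map u"
  shows "nilpotent_map (left_adjoint u)"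
proof -
  obtain m where m: "\<And>a. (u ^^ m) a = 0"
    using assms(2) unfolding nilpotent_map_def by blast
  have "(left_adjoint u ^^ m) a = 0" for a
    by (intro form_nondegenerate_left)
      (simp add: form_left_adjoint_funpow[OF assms(1)] m form_zero)
  then show ?thesis unfolding nilpotent_map_def by blast
qed

theorem nakayama_jacobian_eq_left_adjoint_one:
  assumes "algebra_endomorphism scale u"
  shows "nakayama_jacobian form u = left_adjoint u 1"
  unfolding nakayama_jacobian_def
proof (rule the1_equality[OF nakayama_jacobian_ex1[OF assms]], intro allI)
  fix a b
  have linear: "Vector_Spaces.linear scale scale u" and mult: "u (a * b) = u a * u b"
    using assms by (auto simp: algebra_endomorphism_def)
  have "form (u a) (u b) = form 1 (u (a * b))"
    unfolding mult by (rule form_one(2))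
  also have "\<dots> = form (left_adjoint u 1 * a) b"
    by (simp add: form_left_adjoint[OF linear] form_assoc)
  finally show "form (u a) (u b) = form (left_adjoint u 1 * a) b" .
qed

lemma form_inv_nakayama_automorphism:
  "form (inv (nakayama_automorphism scale form) a) b = form b a"
proof -
  let ?\<sigma> = "nakayama_automorphism scale form"
  have "algebra_automorphism scale ?\<sigma> \<and> (\<forall>a b. form a b = form b (?\<sigma> a))"
    unfolding nakayama_automorphism_def by (rule theI'[OF nakayama_automorphism_ex1])
  then have "bij ?\<sigma>" and "form (inv ?\<sigma> a) b = form b (?\<sigma> (inv ?\<sigma> a))"
    by (auto simp: algebra_automorphism_def)
  then show ?thesis
    by (simp add: bij_is_surj surj_f_inv_f)
qed

theorem left_adjoint_derivation_one:
  assumes "derivation scale \<delta>"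
  shows "left_adjoint \<delta> 1 = inv (nakayama_automorphism scale form) (nakayama_divergence form \<delta>)"
proof (rule left_adjoint_eqI)
  fix b
  let ?d = "nakayama_divergence form \<delta>"
  have div: "form (\<delta> a) b + form a (\<delta> b) = form a (b * ?d)" for a b
    using theI'[OF nakayama_divergence_ex1[OF assms]]
    unfolding nakayama_divergence_def by blast
  have "form (inv (nakayama_automorphism scale form) ?d) b = form 1 (b * ?d)"
    by (simp add: form_inv_nakayama_automorphism flip: form_one(2))
  also have "\<dots> = form (\<delta> 1) b + form 1 (\<delta> b)"
    by (rule div[symmetric])
  also have "\<dots> = form 1 (\<delta> b)"
    by (simp add: derivation_one[OF assms] form_zero)
  finally show "form (inv (nakayama_automorphism scale form) ?d) b = form 1 (\<delta> b)" .
qed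

end

lemma left_adjoint_exp_derivation:
  fixes scale :: "'k::field_char_0 \<Rightarrow> 'a::{ring,monoid_mult} \<Rightarrow> 'a"
  assumes "frobenius_algebra scale form"
    and "Vector_Spaces.linear scale scale \<delta>" and "nilpotent_map \<delta>"
  shows "frobenius_algebra.left_adjoint form (exp_derivation scale \<delta> t) a
    = exp_derivation scale (frobenius_algebra.left_adjoint form \<delta>) t a"
proof -
  interpret frobenius_algebra scale form by fact
  obtain m where m: "\<And>k a. m \<le> k \<Longrightarrow> (\<delta> ^^ k) a = 0"
    using assms(3) by (rule nilpotent_mapE) blast
  obtain n where n: "\<And>k a. n \<le> k \<Longrightarrow> (left_adjoint \<delta> ^^ k) a = 0"
    using nilpotent_map_left_adjoint[OF assms(2,3)] by (rule nilpotent_mapE) blast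
  show ?thesis
  proof (rule left_adjoint_eqI)
    fix b
    let ?N = "max m n"
    have "form (exp_derivation scale (left_adjoint \<delta>) t a) b
        = (\<Sum>k<?N. t ^ k / fact k * form ((left_adjoint \<delta> ^^ k) a) b)"
      by (simp add: exp_derivation_eq_sum[OF vector_space_axioms, of ?N] n form_sum_left
          form_simps)
    also have "\<dots> = (\<Sum>k<?N. t ^ k / fact k * form a ((\<delta> ^^ k) b))"
      by (simp only: form_left_adjoint_funpow[OF assms(2)])
    also have "\<dots> = form a (exp_derivation scale \<delta> t b)"
      by (simp add: exp_derivation_eq_sum[OF vector_space_axioms, of ?N] m form_sum_right
          form_simps)
    finally show "form (exp_derivation scale (left_adjoint \<delta>) t a) b
        = form a (exp_derivation scale \<delta> t b)" .
  qed
qed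

theorem proposition11:
  fixes scale :: "'k::field_char_0 \<Rightarrow> 'a::{ring,monoid_mult} \<Rightarrow> 'a"
    and form :: "'a \<Rightarrow> 'a \<Rightarrow> 'k"
    and \<sigma> \<delta> :: "'a \<Rightarrow> 'a"
  assumes "frobenius_algebra scale form"
    and "\<sigma> = nakayama_automorphism scale form"
    and "derivation scale \<delta>"
    and "nilpotent_map \<delta>"
  shows "has_polynomial_derivative_at_0 scale
           (\<lambda>t. nakayama_jacobian form (exp_derivation scale \<delta> t))
           (inv \<sigma> (nakayama_divergence form \<delta>))"
proof -
  interpret frobenius_algebra scale form by fact
  have linear: "Vector_Spaces.linear scale scale \<delta>"
    using assms(3) by (simp add: derivation_def)
  have "nakayama_jacobian form (exp_derivation scale \<delta> t)
      = exp_derivation scale (left_adjoint \<delta>) t 1" for t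
    using nakayama_jacobian_eq_left_adjoint_one
      [OF algebra_endomorphism_exp_derivation[OF unital_algebra_axioms assms(3,4)]]
    by (simp add: left_adjoint_exp_derivation[OF assms(1) linear assms(4)])
  moreover have "left_adjoint \<delta> 1 = inv \<sigma> (nakayama_divergence form \<delta>)"
    unfolding assms(2) using assms(3) by (rule left_adjoint_derivation_one)
  ultimately show ?thesis
    using has_polynomial_derivative_at_0_exp_derivation
      [OF vector_space_axioms nilpotent_map_left_adjoint[OF linear assms(4)], of 1]
    by simp
qed

end
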